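(* $(\mathcal{C}^{N,M},\odot)$ is an Abelian group, where $\odot$ is the Hadamard (entrywise) product; and matrix scaling operations, i.e. the maps $A\mapsto\mathrm{diag}(\boldsymbol{x})\,A$ and $A\mapsto A\,\mathrm{diag}(\boldsymbol{x})$ with $\boldsymbol{x}\in(\mathbb{R}\setminus\{0\})^{MN}$, are permutations in $\mathcal{C}^{N,M}$ (bijections of $\mathcal{C}^{N,M}$ onto itself).
   Context: The set $\mathcal{C}_L^N$ of L-CoLT (lower-collinear triangular) matrices consists of all $B=[b_{i,j}]\in\mathbb{R}^{N\times N}$ with $b_{i,j}=0$ for $i<j$ and $b_{i+1,j}/b_{i,j}=r_i$ for $j\le i$ (with $i\le N-1$), for some vector $\boldsymbol{r}\in(\mathbb{R}\setminus\{0\})^{N-1}$. The set $\mathcal{C}_U^N$ of U-CoLT (upper-collinear triangular) matrices consists of all $B=[b_{i,j}]\in\mathbb{R}^{N\times N}$ with $b_{i,j}=0$ for $i\ge j$ and $b_{i-1,j}/b_{i,j}=r'_{i-1}$ for $i<j$ (with $i\ge2$), for some vector $\boldsymbol{r}'\in(\mathbb{R}\setminus\{0\})^{N-2}$. $\mathcal{C}^N=\{B+B' : B\in\mathcal{C}_L^N,\ B'\in\mathcal{C}_U^N\}$. A matrix $A\in\mathbb{R}^{MN\times MN}$ is partitioned into $M^2$ uniform blocks $A_{i,j}\in\mathbb{R}^{N\times N}$, $1\le i,j\le M$. A vector in $\mathbb{R}^{kN}$ is partitioned into $k$ consecutive blocks of length $N$, the $i$-th block of $\boldsymbol{r}$ being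 $\boldsymbol{r}_i\in\mathbb{R}^N$. $\mathcal{C}^{N,M}$ is the set of $A\in\mathbb{R}^{MN\times MN}$ such that $A_{k,k}\in\mathcal{C}^N$ for all $k$ and there are $\boldsymbol{r}^L,\boldsymbol{r}^U\in(\mathbb{R}\setminus\{0\})^{(M-1)N}$ with $A_{i+1,j}=\mathrm{diag}(\boldsymbol{r}^L_i)A_{i,j}$ for $j\le i$ (with $i\le M-1$) and $A_{i-1,j}=\mathrm{diag}(\boldsymbol{r}^U_{i-1})A_{i,j}$ for $i\le j$ (with $i\ge2$).
   Formalization: The definitions of L-CoLT and U-CoLT matrices additionally require every entry of the triangle to be nonzero; this adds only b_{N,N} ≠ 0 and b_{1,2} ≠ 0, without which the set is not a group (for N=M=1 it would be all of ℝ). *)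

theory Defs
  imports "Jordan_Normal_Form.Matrix"
begin

text \<open>Matrices and vectors are indexed from 0, so every index is one less than in the usual
  1-based notation; the length of each ratio vector is unchanged.\<close>

definition nz_vec :: "nat \<Rightarrow> real vec set" where
  "nz_vec n = {x \<in> carrier_vec n. \<forall>i<n. x $ i \<noteq> 0}"

definition diag_vec :: "real vec \<Rightarrow> real mat" where
  "diag_vec x = mat_diag (dim_vec x) (\<lambda>i. x $ i)"

text \<open>The ratio conditions below force all entries of the relevant triangle to be nonzero, with the
  exception of the corner entry that occurs in no ratio: the last diagonal entry in the lower case
  and the entry in row 0, column 1 in the upper case. These corners must be nonzero as well, for
  otherwise there are matrices without an entrywise inverse. Hence the explicit requirement that
  the entries of the triangle do not vanish.\<close>

definition L_CoLT :: "nat \<Rightarrow> real mat set" where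
  "L_CoLT N = {B \<in> carrier_mat N N.
     (\<forall>i<N. \<forall>j<N. i < j \<longrightarrow> B $$ (i, j) = 0) \<and>
     (\<forall>i<N. \<forall>j\<le>i. B $$ (i, j) \<noteq> 0) \<and>
     (\<exists>r \<in> nz_vec (N - 1). \<forall>i j. Suc i < N \<and> j \<le> i \<longrightarrow>
        B $$ (Suc i, j) / B $$ (i, j) = r $ i)}"

definition U_CoLT :: "nat \<Rightarrow> real mat set" where
  "U_CoLT N = {B \<in> carrier_mat N N.
     (\<forall>i<N. \<forall>j\<le>i. B $$ (i, j) = 0) \<and>
     (\<forall>i<N. \<forall>j<N. i < j \<longrightarrow> B $$ (i, j) \<noteq> 0) \<and>
     (\<exists>r \<in> nz_vec (N - 2). \<forall>i j. Suc i < j \<and> j < N \<longrightarrow>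
        B $$ (i, j) / B $$ (Suc i, j) = r $ i)}"

definition CoLT :: "nat \<Rightarrow> real mat set" where
  "CoLT N = {B + B' | B B'. B \<in> L_CoLT N \<and> B' \<in> U_CoLT N}"

definition mat_block :: "nat \<Rightarrow> real mat \<Rightarrow> nat \<Rightarrow> nat \<Rightarrow> real mat" where
  "mat_block N A i j = mat N N (\<lambda>(a, b). A $$ (i * N + a, j * N + b))"

definition vec_block :: "nat \<Rightarrow> real vec \<Rightarrow> nat \<Rightarrow> real vec" where
  "vec_block N r i = vec N (\<lambda>a. r $ (i * N + a))"

definition block_CoLT :: "nat \<Rightarrow> nat \<Rightarrow> real mat set" where
  "block_CoLT N M = {A \<in> carrier_mat (M * N) (M * N).
     (\<forall>k<M. mat_block N A k k \<in> CoLT N) \<and>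
     (\<exists>rL \<in> nz_vec ((M - 1) * N). \<exists>rU \<in> nz_vec ((M - 1) * N).
        (\<forall>i j. Suc i < M \<and> j \<le> i \<longrightarrow>
           mat_block N A (Suc i) j = diag_vec (vec_block N rL i) * mat_block N A i j) \<and>
        (\<forall>i j. Suc i \<le> j \<and> j < M \<longrightarrow>
           mat_block N A i j = diag_vec (vec_block N rU i) * mat_block N A (Suc i) j))}"

definition hadamard :: "real mat \<Rightarrow> real mat \<Rightarrow> real mat" where
  "hadamard A B = mat (dim_row A) (dim_col A) (\<lambda>(i, j). A $$ (i, j) * B $$ (i, j))"

definition ones_mat :: "nat \<Rightarrow> real mat" where
  "ones_mat n = mat n n (\<lambda>_. 1)"

definition CoLT_group :: "nat \<Rightarrow> nat \<Rightarrow> real mat monoid" where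
  "CoLT_group N M =
     \<lparr>carrier = block_CoLT N M, monoid.mult = hadamard, one = ones_mat (M * N)\<rparr>"

end

theory Submission
  imports Defs
begin

text \<open>A matrix lies in \<^term>\<open>block_CoLT N M\<close> iff its entries are nonzero and certain of its
  \<open>2 \<times> 2\<close> minors vanish: a ratio of two rows is constant on a set of columns iff all minors
  formed by these rows and columns vanish. For any prescribed set of minors, the condition
  \<open>A\<^sub>p\<^sub>c A\<^sub>q\<^sub>d = A\<^sub>p\<^sub>d A\<^sub>q\<^sub>c\<close> is an equality of monomials, so it is preserved by entrywise products
  and inverses; a row or column scaling multiplies both sides by the same factor.\<close>

section \<open>Nonvanishing matrices with prescribed vanishing minors\<close>

text \<open>A quadruple lists two rows and then two columns. The condition is free of division, and
  \<open>S\<close> stays a parameter so that the same class can describe both a diagonal block and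
  the whole block matrix.\<close>

definition minors_mat :: "nat \<Rightarrow> (nat \<times> nat \<times> nat \<times> nat) set \<Rightarrow> real mat set" where
  "minors_mat n S = {A \<in> carrier_mat n n. (\<forall>i<n. \<forall>j<n. A $$ (i, j) \<noteq> 0) \<and>
     (\<forall>(p, q, c, d) \<in> S. A $$ (p, c) * A $$ (q, d) = A $$ (p, d) * A $$ (q, c))}"

text \<open>Entries outside the dimensions of a matrix are unspecified, so the entrywise formulas
  apply to a quadruple only if all four indices are in range.\<close>

abbreviation index_quads :: "nat \<Rightarrow> (nat \<times> nat \<times> nat \<times> nat) set" where
  "index_quads n \<equiv> {..<n} \<times> {..<n} \<times> {..<n} \<times> {..<n}"

lemma minors_matI:
  assumes "A \<in> carrier_mat n n"
    and "\<And>i j. i < n \<Longrightarrow> j < n \<Longrightarrow> A $$ (i, j) \<noteq> 0"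
    and "\<And>p q c d. (p, q, c, d) \<in> S \<Longrightarrow> A $$ (p, c) * A $$ (q, d) = A $$ (p, d) * A $$ (q, c)"
  shows "A \<in> minors_mat n S"
  using assms unfolding minors_mat_def by auto

lemma minors_matD:
  assumes "A \<in> minors_mat n S"
  shows "A \<in> carrier_mat n n"
    and "i < n \<Longrightarrow> j < n \<Longrightarrow> A $$ (i, j) \<noteq> 0"
    and "(p, q, c, d) \<in> S \<Longrightarrow> A $$ (p, c) * A $$ (q, d) = A $$ (p, d) * A $$ (q, c)"
  using assms unfolding minors_mat_def by auto

section \<open>Closure under entrywise products and inverses\<close>

lemma index_hadamard:
  assumes "A \<in> carrier_mat n m" "i < n" "j < m"
  shows "hadamard A B $$ (i, j) = A $$ (i, j) * B $$ (i, j)"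
  using assms by (auto simp: hadamard_def)

lemma hadamard_carrier: "A \<in> carrier_mat n m \<Longrightarrow> hadamard A B \<in> carrier_mat n m"
  by (auto simp: hadamard_def)

lemma hadamard_minors_mat:
  assumes S: "S \<subseteq> index_quads n" and A: "A \<in> minors_mat n S" and B: "B \<in> minors_mat n S"
  shows "hadamard A B \<in> minors_mat n S"
proof (rule minors_matI)
  fix p q c d assume pq: "(p, q, c, d) \<in> S"
  with S have lt: "p < n" "q < n" "c < n" "d < n" by auto
  \<comment> \<open>The minor equations of \<open>A\<close> and \<open>B\<close> are multiplied;
    regrouping the factors by position gives the equation of the product.\<close>
  from minors_matD(3)[OF A pq] minors_matD(3)[OF B pq]
  have "(A $$ (p, c) * A $$ (q, d)) * (B $$ (p, c) * B $$ (q, d))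
      = (A $$ (p, d) * A $$ (q, c)) * (B $$ (p, d) * B $$ (q, c))"
    by simp
  then show "hadamard A B $$ (p, c) * hadamard A B $$ (q, d)
      = hadamard A B $$ (p, d) * hadamard A B $$ (q, c)"
    using lt by (simp add: index_hadamard[OF minors_matD(1)[OF A]] mult_ac)
qed (use minors_matD[OF A] minors_matD[OF B] in \<open>auto simp: index_hadamard hadamard_carrier\<close>)

lemma inverse_minors_mat:
  assumes S: "S \<subseteq> index_quads n" and A: "A \<in> minors_mat n S"
  shows "map_mat inverse A \<in> minors_mat n S"
proof (rule minors_matI)
  fix p q c d assume pq: "(p, q, c, d) \<in> S"
  with S have lt: "p < n" "q < n" "c < n" "d < n" by auto
  have "inverse (A $$ (p, c) * A $$ (q, d)) = inverse (A $$ (p, d) * A $$ (q, c))"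
    using minors_matD(3)[OF A pq] by simp
  then show "map_mat inverse A $$ (p, c) * map_mat inverse A $$ (q, d)
      = map_mat inverse A $$ (p, d) * map_mat inverse A $$ (q, c)"
    using lt minors_matD(1)[OF A] by simp
qed (use minors_matD[OF A] in auto)

lemma ones_minors_mat: "S \<subseteq> index_quads n \<Longrightarrow> ones_mat n \<in> minors_mat n S"
  by (rule minors_matI) (auto simp: ones_mat_def)

lemma comm_group_minors_mat:
  assumes S: "S \<subseteq> index_quads n"
  shows "comm_group \<lparr>carrier = minors_mat n S, monoid.mult = hadamard, one = ones_mat n\<rparr>"
proof (rule comm_groupI, simp_all)
  show "hadamard A B \<in> minors_mat n S" if "A \<in> minors_mat n S" "B \<in> minors_mat n S" for A B
    using that by (rule hadamard_minors_mat[OF S])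
  show "ones_mat n \<in> minors_mat n S"
    using S by (rule ones_minors_mat)
  show "hadamard (hadamard A B) C = hadamard A (hadamard B C)"
    if "A \<in> minors_mat n S" "B \<in> minors_mat n S" "C \<in> minors_mat n S" for A B C
    using that[THEN minors_matD(1)] by (intro eq_matI) (auto simp: hadamard_def)
  show "hadamard A B = hadamard B A" if "A \<in> minors_mat n S" "B \<in> minors_mat n S" for A B
    using that[THEN minors_matD(1)] by (intro eq_matI) (auto simp: hadamard_def)
  show "hadamard (ones_mat n) A = A" if "A \<in> minors_mat n S" for A
    using that[THEN minors_matD(1)] by (intro eq_matI) (auto simp: hadamard_def ones_mat_def)
  show "\<exists>B\<in>minors_mat n S. hadamard B A = ones_mat n" if A: "A \<in> minors_mat n S" for A
  proof
    \<comment> \<open>No entry of \<open>A\<close> vanishes, so \<open>inverse\<close> is a true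
      inverse at every position.\<close>
    show "hadamard (map_mat inverse A) A = ones_mat n"
      using minors_matD[OF A] by (intro eq_matI) (auto simp: hadamard_def ones_mat_def)
  qed (rule inverse_minors_mat[OF S A])
qed

section \<open>Row and column scalings by nonvanishing vectors\<close>

lemma index_diag_vec_mult_left:
  assumes "x \<in> carrier_vec n" "A \<in> carrier_mat n m" "i < n" "j < m"
  shows "(diag_vec x * A) $$ (i, j) = x $ i * A $$ (i, j)"
  using assms by (auto simp: diag_vec_def mat_diag_mult_left)

lemma index_diag_vec_mult_right:
  assumes "x \<in> carrier_vec n" "A \<in> carrier_mat m n" "i < m" "j < n"
  shows "(A * diag_vec x) $$ (i, j) = A $$ (i, j) * x $ j"
  using assms by (auto simp: diag_vec_def mat_diag_mult_right)

lemma diag_vec_carrier: "x \<in> carrier_vec n \<Longrightarrow> diag_vec x \<in> carrier_mat n n"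
  by (auto simp: diag_vec_def)

text \<open>Each monomial contains one entry of row \<open>p\<close> and one of row
  \<open>q\<close>, so both sides pick up the factor \<open>x $ p * x $ q\<close>.\<close>

lemma diag_vec_mult_minors_mat:
  assumes S: "S \<subseteq> index_quads n" and A: "A \<in> minors_mat n S" and x: "x \<in> nz_vec n"
  shows "diag_vec x * A \<in> minors_mat n S"
proof (rule minors_matI)
  have x': "x \<in> carrier_vec n" using x by (simp add: nz_vec_def)
  note A' = minors_matD(1)[OF A]
  show "diag_vec x * A \<in> carrier_mat n n"
    using diag_vec_carrier[OF x'] A' by simp
  show "(diag_vec x * A) $$ (i, j) \<noteq> 0" if "i < n" "j < n" for i j
    using that x minors_matD(2)[OF A] by (simp add: index_diag_vec_mult_left[OF x' A'] nz_vec_def)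
  fix p q c d assume pq: "(p, q, c, d) \<in> S"
  with S have "p < n" "q < n" "c < n" "d < n" by auto
  then show "(diag_vec x * A) $$ (p, c) * (diag_vec x * A) $$ (q, d)
      = (diag_vec x * A) $$ (p, d) * (diag_vec x * A) $$ (q, c)"
    using minors_matD(3)[OF A pq] by (simp add: index_diag_vec_mult_left[OF x' A'])
qed

text \<open>Each monomial contains one entry of column \<open>c\<close> and one of column
  \<open>d\<close>, so the common factor is \<open>x $ c * x $ d\<close>.\<close>

lemma mult_diag_vec_minors_mat:
  assumes S: "S \<subseteq> index_quads n" and A: "A \<in> minors_mat n S" and x: "x \<in> nz_vec n"
  shows "A * diag_vec x \<in> minors_mat n S"
proof (rule minors_matI)
  have x': "x \<in> carrier_vec n" using x by (simp add: nz_vec_def)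
  note A' = minors_matD(1)[OF A]
  show "A * diag_vec x \<in> carrier_mat n n"
    using diag_vec_carrier[OF x'] A' by simp
  show "(A * diag_vec x) $$ (i, j) \<noteq> 0" if "i < n" "j < n" for i j
    using that x minors_matD(2)[OF A] by (simp add: index_diag_vec_mult_right[OF x' A'] nz_vec_def)
  fix p q c d assume pq: "(p, q, c, d) \<in> S"
  with S have "p < n" "q < n" "c < n" "d < n" by auto
  then show "(A * diag_vec x) $$ (p, c) * (A * diag_vec x) $$ (q, d)
      = (A * diag_vec x) $$ (p, d) * (A * diag_vec x) $$ (q, c)"
    using minors_matD(3)[OF A pq] by (simp add: index_diag_vec_mult_right[OF x' A'])
qed

lemma nz_vec_inverse: "x \<in> nz_vec n \<Longrightarrow> map_vec inverse x \<in> nz_vec n"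
  by (auto simp: nz_vec_def)

lemma diag_vec_inverse:
  assumes "x \<in> nz_vec n"
  shows "diag_vec x * diag_vec (map_vec inverse x) = 1\<^sub>m n"
    and "diag_vec (map_vec inverse x) * diag_vec x = 1\<^sub>m n"
  using assms by (auto simp: nz_vec_def diag_vec_def mat_diag_diag intro!: eq_matI)
     (auto simp: mat_diag_def)

text \<open>The inverse map is the scaling by the entrywise inverse of \<open>x\<close>, which is
  again nonvanishing and hence preserves the class as well.\<close>

lemma bij_betw_diag_vec_mult_minors_mat:
  assumes S: "S \<subseteq> index_quads n" and x: "x \<in> nz_vec n"
  shows "bij_betw (\<lambda>A. diag_vec x * A) (minors_mat n S) (minors_mat n S)"
proof -
  let ?D = "diag_vec x" and ?E = "diag_vec (map_vec inverse x)"
  have D: "?D \<in> carrier_mat n n" and E: "?E \<in> carrier_mat n n"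
    using x nz_vec_inverse[OF x] by (auto simp: nz_vec_def intro: diag_vec_carrier)
  show ?thesis
  proof (rule bij_betw_byWitness[where f' = "\<lambda>A. ?E * A"])
    show "\<forall>A\<in>minors_mat n S. ?E * (?D * A) = A"
      using assoc_mult_mat[OF E D] diag_vec_inverse[OF x] minors_matD(1) by (metis left_mult_one_mat)
    show "\<forall>A\<in>minors_mat n S. ?D * (?E * A) = A"
      using assoc_mult_mat[OF D E] diag_vec_inverse[OF x] minors_matD(1) by (metis left_mult_one_mat)
  qed (auto intro: diag_vec_mult_minors_mat[OF S] x nz_vec_inverse)
qed

lemma bij_betw_mult_diag_vec_minors_mat:
  assumes S: "S \<subseteq> index_quads n" and x: "x \<in> nz_vec n"
  shows "bij_betw (\<lambda>A. A * diag_vec x) (minors_mat n S) (minors_mat n S)"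
proof -
  let ?D = "diag_vec x" and ?E = "diag_vec (map_vec inverse x)"
  have D: "?D \<in> carrier_mat n n" and E: "?E \<in> carrier_mat n n"
    using x nz_vec_inverse[OF x] by (auto simp: nz_vec_def intro: diag_vec_carrier)
  show ?thesis
  proof (rule bij_betw_byWitness[where f' = "\<lambda>A. A * ?E"])
    show "\<forall>A\<in>minors_mat n S. A * ?D * ?E = A"
      using assoc_mult_mat[OF _ D E] diag_vec_inverse[OF x] minors_matD(1)
      by (metis right_mult_one_mat)
    show "\<forall>A\<in>minors_mat n S. A * ?E * ?D = A"
      using assoc_mult_mat[OF _ E D] diag_vec_inverse[OF x] minors_matD(1)
      by (metis right_mult_one_mat)
  qed (auto intro: mult_diag_vec_minors_mat[OF S] x nz_vec_inverse)
qed

section \<open>CoLT matrices in terms of minors\<close>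

text \<open>Consecutive rows are compared only on columns where both entries lie in the same
  triangle: the lower one including the diagonal, or the strict upper one. No minor mixes the two
  triangles.\<close>

definition CoLT_minors :: "nat \<Rightarrow> (nat \<times> nat \<times> nat \<times> nat) set" where
  "CoLT_minors N =
     {(Suc i, i, j, j') | i j j'. Suc i < N \<and> j \<le> i \<and> j' \<le> i} \<union>
     {(i, Suc i, j, j') | i j j'. Suc i < j \<and> Suc i < j' \<and> j < N \<and> j' < N}"

text \<open>For a fixed pair of rows, the ratios in any two admissible columns equal the same entry
  of the ratio vector; cross-multiplying gives the minor equation.\<close>

lemma CoLT_subset_minors_mat: "CoLT N \<subseteq> minors_mat N (CoLT_minors N)"
proof
  fix A assume "A \<in> CoLT N"
  then obtain B B' where A: "A = B + B'" and B: "B \<in> L_CoLT N" and B': "B' \<in> U_CoLT N"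
    by (auto simp: CoLT_def)
  have BC: "B \<in> carrier_mat N N" "B' \<in> carrier_mat N N"
    using B B' by (auto simp: L_CoLT_def U_CoLT_def)
  \<comment> \<open>The two summands have complementary supports, so every entry of the sum comes
    from exactly one of them.\<close>
  have AB: "A $$ (i, j) = (if j \<le> i then B $$ (i, j) else B' $$ (i, j))" if "i < N" "j < N" for i j
    using that B B' BC by (auto simp: A L_CoLT_def U_CoLT_def)
  have nzB: "B $$ (i, j) \<noteq> 0" if "i < N" "j \<le> i" for i j
    using B that by (auto simp: L_CoLT_def)
  have nzB': "B' $$ (i, j) \<noteq> 0" if "i < j" "j < N" for i j
    using B' that by (auto simp: U_CoLT_def)
  obtain r where r: "\<And>i j. Suc i < N \<Longrightarrow> j \<le> i \<Longrightarrow> B $$ (Suc i, j) / B $$ (i, j) = r $ i"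
    using B by (auto simp: L_CoLT_def)
  obtain r' where r': "\<And>i j. Suc i < j \<Longrightarrow> j < N \<Longrightarrow> B' $$ (i, j) / B' $$ (Suc i, j) = r' $ i"
    using B' by (auto simp: U_CoLT_def)
  show "A \<in> minors_mat N (CoLT_minors N)"
  proof (rule minors_matI)
    show "A \<in> carrier_mat N N" using A BC by simp
    show "A $$ (i, j) \<noteq> 0" if "i < N" "j < N" for i j
      using that nzB nzB' by (auto simp: AB)
    fix p q c d assume "(p, q, c, d) \<in> CoLT_minors N"
    then consider (low) "p = Suc q" "Suc q < N" "c \<le> q" "d \<le> q"
      | (up) "q = Suc p" "Suc p < c" "Suc p < d" "c < N" "d < N"
      by (auto simp: CoLT_minors_def)
    then show "A $$ (p, c) * A $$ (q, d) = A $$ (p, d) * A $$ (q, c)"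
    proof cases
      case low
      then have "B $$ (p, c) / B $$ (q, c) = B $$ (p, d) / B $$ (q, d)" using r by simp
      with low show ?thesis by (simp add: AB nzB frac_eq_eq)
    next
      case up
      then have "B' $$ (p, c) / B' $$ (q, c) = B' $$ (p, d) / B' $$ (q, d)" using r' by simp
      with up show ?thesis by (simp add: AB nzB' frac_eq_eq)
    qed
  qed
qed

text \<open>The matrix is cut along the diagonal, and each ratio vector is read off from a column
  that is admissible for every pair of rows in question.\<close>

lemma minors_mat_subset_CoLT: "minors_mat N (CoLT_minors N) \<subseteq> CoLT N"
proof
  fix A assume A: "A \<in> minors_mat N (CoLT_minors N)"
  note AC = minors_matD(1)[OF A] and nz = minors_matD(2)[OF A]
  let ?B = "mat N N (\<lambda>(i, j). if j \<le> i then A $$ (i, j) else 0)"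
  let ?B' = "mat N N (\<lambda>(i, j). if i < j then A $$ (i, j) else 0)"
  \<comment> \<open>Column 0 is the reference column, since \<open>0 \<le> i\<close> always
    holds.\<close>
  have low: "A $$ (Suc i, j) / A $$ (i, j) = A $$ (Suc i, 0) / A $$ (i, 0)"
    if "Suc i < N" "j \<le> i" for i j
  proof -
    have "(Suc i, i, j, 0) \<in> CoLT_minors N" using that by (auto simp: CoLT_minors_def)
    from minors_matD(3)[OF A this] show ?thesis using that nz[of i j] nz[of i 0] by (simp add: frac_eq_eq)
  qed
  \<comment> \<open>The last column serves as reference: \<open>Suc i < j\<close> and
    \<open>j < N\<close> give \<open>Suc i < N - 1\<close>. This bound also explains the length
    \<open>N - 2\<close> of the upper ratio vector.\<close>
  have up: "A $$ (i, j) / A $$ (Suc i, j) = A $$ (i, N - 1) / A $$ (Suc i, N - 1)"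
    if "Suc i < j" "j < N" for i j
  proof -
    have "(i, Suc i, j, N - 1) \<in> CoLT_minors N" using that by (auto simp: CoLT_minors_def)
    from minors_matD(3)[OF A this] show ?thesis
      using that nz[of "Suc i" j] nz[of "Suc i" "N - 1"] by (simp add: frac_eq_eq)
  qed
  have "?B \<in> L_CoLT N"
  proof -
    let ?r = "vec (N - 1) (\<lambda>i. A $$ (Suc i, 0) / A $$ (i, 0))"
    have "?r \<in> nz_vec (N - 1)" by (auto simp: nz_vec_def nz)
    moreover have "?B $$ (Suc i, j) / ?B $$ (i, j) = ?r $ i" if "Suc i < N" "j \<le> i" for i j
      using that low[of i j] by simp
    moreover have "?B \<in> carrier_mat N N" by simp
    moreover have "\<forall>i<N. \<forall>j<N. i < j \<longrightarrow> ?B $$ (i, j) = 0" by simp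
    moreover have "\<forall>i<N. \<forall>j\<le>i. ?B $$ (i, j) \<noteq> 0" by (simp add: nz)
    ultimately show ?thesis
      unfolding L_CoLT_def by blast
  qed
  moreover have "?B' \<in> U_CoLT N"
  proof -
    let ?r = "vec (N - 2) (\<lambda>i. A $$ (i, N - 1) / A $$ (Suc i, N - 1))"
    have "?r \<in> nz_vec (N - 2)" by (auto simp: nz_vec_def nz)
    moreover have "?B' $$ (i, j) / ?B' $$ (Suc i, j) = ?r $ i" if "Suc i < j" "j < N" for i j
      using that up[of i j] by simp
    moreover have "?B' \<in> carrier_mat N N" by simp
    moreover have "\<forall>i<N. \<forall>j\<le>i. ?B' $$ (i, j) = 0" by simp
    moreover have "\<forall>i<N. \<forall>j<N. i < j \<longrightarrow> ?B' $$ (i, j) \<noteq> 0" by (simp add: nz)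
    ultimately show ?thesis
      unfolding U_CoLT_def by blast
  qed
  moreover have "A = ?B + ?B'"
    using AC by (intro eq_matI) auto
  ultimately show "A \<in> CoLT N"
    unfolding CoLT_def by blast
qed

lemma CoLT_eq_minors_mat: "CoLT N = minors_mat N (CoLT_minors N)"
  using CoLT_subset_minors_mat minors_mat_subset_CoLT by blast

section \<open>Block CoLT matrices in terms of minors\<close>

text \<open>The first family shifts the minors of a block to the diagonal blocks. In the other two,
  the rows have the same offset \<open>a\<close> in consecutive block rows while the columns vary
  freely over the admissible block columns, because a diagonal factor multiplies a whole row by one
  scalar. Both ranges of block columns include a diagonal block: that of row \<open>i\<close> below,
  that of row \<open>Suc i\<close> above.\<close>

definition block_CoLT_minors :: "nat \<Rightarrow> nat \<Rightarrow> (nat \<times> nat \<times> nat \<times> nat) set" where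
  "block_CoLT_minors N M =
     {(k * N + p, k * N + q, k * N + c, k * N + d) | k p q c d.
        k < M \<and> (p, q, c, d) \<in> CoLT_minors N} \<union>
     {(Suc i * N + a, i * N + a, j * N + b, j' * N + b') | i a j b j' b'.
        Suc i < M \<and> j \<le> i \<and> j' \<le> i \<and> a < N \<and> b < N \<and> b' < N} \<union>
     {(i * N + a, Suc i * N + a, j * N + b, j' * N + b') | i a j b j' b'.
        Suc i \<le> j \<and> Suc i \<le> j' \<and> j < M \<and> j' < M \<and> a < N \<and> b < N \<and> b' < N}"

section \<open>Index arithmetic and block equations entry by entry\<close>

lemma block_index_less: "i < M \<Longrightarrow> a < N \<Longrightarrow> i * N + a < M * (N :: nat)"
  using mult_le_mono1[of "Suc i" M N] by simp

lemma block_index_cases: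
  assumes "p < M * (N :: nat)"
  obtains i a where "p = i * N + a" "i < M" "a < N"
proof
  show "p = p div N * N + p mod N" by simp
  show "p div N < M" using assms by (simp add: less_mult_imp_div_less)
  show "p mod N < N" using assms by (cases "N = 0") auto
qed

lemma CoLT_minors_subset: "CoLT_minors N \<subseteq> index_quads N"
  by (auto simp: CoLT_minors_def)

lemma block_CoLT_minors_subset: "block_CoLT_minors N M \<subseteq> index_quads (M * N)"
proof -
  have "(k * N + p, k * N + q, k * N + c, k * N + d) \<in> index_quads (M * N)"
    if "k < M" "(p, q, c, d) \<in> CoLT_minors N" for k p q c d
    using that CoLT_minors_subset[of N] block_index_less[OF \<open>k < M\<close>] by blast
  moreover have "i * N + a < M * N" "Suc i * N + a < M * N" if "Suc i < M" "a < N" for i a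
    using that block_index_less[of i M a N] block_index_less[of "Suc i" M a N] by simp_all
  moreover have "j * N + b < M * N" if "j \<le> i" "i < M" "b < N" for i j b
    using that block_index_less[of j M b N] by simp
  ultimately show ?thesis
    unfolding block_CoLT_minors_def
    by (intro Un_least; clarsimp simp del: mult_Suc) (meson Suc_lessD le_less_trans le_refl)+
qed

lemma index_mat_block:
  "a < N \<Longrightarrow> b < N \<Longrightarrow> mat_block N A i j $$ (a, b) = A $$ (i * N + a, j * N + b)"
  by (simp add: mat_block_def)

lemma mat_block_carrier: "mat_block N A i j \<in> carrier_mat N N"
  by (simp add: mat_block_def)

text \<open>This makes the block conditions entrywise; the scalar depends on the row offset
  \<open>a\<close> but not on the column offset \<open>b\<close>.\<close>

lemma mat_block_eq_diag_mult_iff: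
  "mat_block N A i j = diag_vec (vec_block N r k) * mat_block N A i' j' \<longleftrightarrow>
   (\<forall>a<N. \<forall>b<N. A $$ (i * N + a, j * N + b) = r $ (k * N + a) * A $$ (i' * N + a, j' * N + b))"
  (is "?l = ?r \<longleftrightarrow> _")
proof -
  have v: "vec_block N r k \<in> carrier_vec N" by (simp add: vec_block_def)
  have c: "?l \<in> carrier_mat N N" "?r \<in> carrier_mat N N"
    using diag_vec_carrier[OF v] mat_block_carrier by auto
  then have "?l = ?r \<longleftrightarrow> (\<forall>a<N. \<forall>b<N. ?l $$ (a, b) = ?r $$ (a, b))"
    by (metis carrier_matD eq_matI)
  then show ?thesis
    by (simp add: index_mat_block index_diag_vec_mult_left[OF v mat_block_carrier])
       (simp add: vec_block_def)
qed

text \<open>Nonvanishing is known at first only for the diagonal blocks and spreads along each block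
  column through the nonzero ratios. The minors then follow from the ratio equations by
  substitution.\<close>

lemma block_CoLT_subset_minors_mat: "block_CoLT N M \<subseteq> minors_mat (M * N) (block_CoLT_minors N M)"
proof
  fix A assume A: "A \<in> block_CoLT N M"
  then have diag: "\<And>k. k < M \<Longrightarrow> mat_block N A k k \<in> minors_mat N (CoLT_minors N)"
    by (auto simp: block_CoLT_def CoLT_eq_minors_mat)
  from A obtain rL rU where rL: "rL \<in> nz_vec ((M - 1) * N)" and rU: "rU \<in> nz_vec ((M - 1) * N)"
    and low: "\<And>i j a b. Suc i < M \<Longrightarrow> j \<le> i \<Longrightarrow> a < N \<Longrightarrow> b < N \<Longrightarrow>
      A $$ (Suc i * N + a, j * N + b) = rL $ (i * N + a) * A $$ (i * N + a, j * N + b)"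
    and up: "\<And>i j a b. Suc i \<le> j \<Longrightarrow> j < M \<Longrightarrow> a < N \<Longrightarrow> b < N \<Longrightarrow>
      A $$ (i * N + a, j * N + b) = rU $ (i * N + a) * A $$ (Suc i * N + a, j * N + b)"
    unfolding block_CoLT_def mat_block_eq_diag_mult_iff mem_Collect_eq by metis
  have nzr: "rL $ (i * N + a) \<noteq> 0" "rU $ (i * N + a) \<noteq> 0" if "Suc i < M" "a < N" for i a
    using that rL rU block_index_less[of i "M - 1" a N] by (auto simp: nz_vec_def)
  have nz: "A $$ (i * N + a, j * N + b) \<noteq> 0" if ij: "i < M" "j < M" and ab: "a < N" "b < N"
    for i j a b
  proof (cases "j \<le> i")
    case True
    then show ?thesis using ij(1)
    \<comment> \<open>Within block column \<open>j\<close>, the induction descends from the diagonal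
      block; each step multiplies by a nonzero entry of \<open>rL\<close>.\<close>
    proof (induction rule: dec_induct)
      case base
      then show ?case
        using minors_matD(2)[OF diag, of j a b] ab ij by (simp add: index_mat_block)
    next
      case (step i)
      then show ?case using low[of i j a b] nzr[of i a] ab by simp
    qed
  next
    case False
    then have "i \<le> j" by simp
    then show ?thesis
    \<comment> \<open>Here the induction climbs from the diagonal block to smaller block rows,
      multiplying by nonzero entries of \<open>rU\<close>.\<close>
    proof (induction rule: inc_induct)
      case base
      then show ?case
        using minors_matD(2)[OF diag, of j a b] ab ij by (simp add: index_mat_block)
    next
      case (step i)
      then show ?case using up[of i j a b] nzr[of i a] ab ij by simp
    qed
  qed
  show "A \<in> minors_mat (M * N) (block_CoLT_minors N M)"
  proof (rule minors_matI)
    show "A \<in> carrier_mat (M * N) (M * N)" using A by (simp add: block_CoLT_def)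
    show "A $$ (p, q) \<noteq> 0" if "p < M * N" "q < M * N" for p q
      using that by (metis block_index_cases nz)
    fix p q c d assume "(p, q, c, d) \<in> block_CoLT_minors N M"
    then consider (D) k p' q' c' d' where "p = k * N + p'" "q = k * N + q'" "c = k * N + c'"
        "d = k * N + d'" "k < M" "(p', q', c', d') \<in> CoLT_minors N"
      | (L) i a j b j' b' where "p = Suc i * N + a" "q = i * N + a" "c = j * N + b"
        "d = j' * N + b'" "Suc i < M" "j \<le> i" "j' \<le> i" "a < N" "b < N" "b' < N"
      | (U) i a j b j' b' where "p = i * N + a" "q = Suc i * N + a" "c = j * N + b"
        "d = j' * N + b'" "Suc i \<le> j" "Suc i \<le> j'" "j < M" "j' < M" "a < N" "b < N" "b' < N"
      unfolding block_CoLT_minors_def by blast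
    then show "A $$ (p, c) * A $$ (q, d) = A $$ (p, d) * A $$ (q, c)"
    proof cases
      case D
      then have "p' < N" "q' < N" "c' < N" "d' < N"
        using CoLT_minors_subset[of N] by auto
      with D minors_matD(3)[OF diag D(6)] show ?thesis
        by (simp add: index_mat_block)
    next
      case L
      \<comment> \<open>Substituting for the entries of row \<open>p\<close> turns both sides into
        the ratio times \<open>A $$ (q, c) * A $$ (q, d)\<close>; the case \<open>U\<close> is the
        same with \<open>rU\<close>.\<close>
      then show ?thesis by (simp add: low del: mult_Suc)
    next
      case U
      then show ?thesis by (simp add: up del: mult_Suc)
    qed
  qed
qed

text \<open>As for a single block, the ratios are read off from the first and the last column of the
  whole matrix, and the minors carry them over to all other admissible columns.\<close>

lemma minors_mat_subset_block_CoLT: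
  assumes "N \<ge> 1" "M \<ge> 1"
  shows "minors_mat (M * N) (block_CoLT_minors N M) \<subseteq> block_CoLT N M"
proof
  fix A assume A: "A \<in> minors_mat (M * N) (block_CoLT_minors N M)"
  have nz: "A $$ (i * N + a, j * N + b) \<noteq> 0" if "i < M" "j < M" "a < N" "b < N" for i j a b
    using that by (intro minors_matD(2)[OF A] block_index_less)
  \<comment> \<open>This is the last column: offset \<open>N - 1\<close> in block column
    \<open>M - 1\<close>.\<close>
  define c where "c = (M - 1) * N + (N - 1)"
  \<comment> \<open>Row \<open>p + N\<close> has the same offset as row \<open>p\<close>, one block
    row further down.\<close>
  define rL where "rL = vec ((M - 1) * N) (\<lambda>p. A $$ (p + N, 0) / A $$ (p, 0))"
  define rU where "rU = vec ((M - 1) * N) (\<lambda>p. A $$ (p, c) / A $$ (p + N, c))"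
  have idx: "rL $ (i * N + a) = A $$ (Suc i * N + a, 0) / A $$ (i * N + a, 0)"
    "rU $ (i * N + a) = A $$ (i * N + a, c) / A $$ (Suc i * N + a, c)" if "Suc i < M" "a < N" for i a
    using that block_index_less[of i "M - 1" a N] by (auto simp: rL_def rU_def add_ac)
  have nz0: "A $$ (i * N + a, 0) \<noteq> 0" "A $$ (i * N + a, c) \<noteq> 0" if "i < M" "a < N" for i a
    using that nz[of i 0 a 0] nz[of i "M - 1" a "N - 1"] assms by (auto simp: c_def)
  have nzr: "rL \<in> nz_vec ((M - 1) * N)" "rU \<in> nz_vec ((M - 1) * N)"
  proof -
    have "rL $ p \<noteq> 0 \<and> rU $ p \<noteq> 0" if p: "p < (M - 1) * N" for p
    proof -
      from p obtain i a where "p = i * N + a" "i < M - 1" "a < N" by (rule block_index_cases)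
      then show ?thesis using idx[of i a] nz0[of i a] nz0[of "Suc i" a] by simp
    qed
    then show "rL \<in> nz_vec ((M - 1) * N)" "rU \<in> nz_vec ((M - 1) * N)"
      by (auto simp: nz_vec_def rL_def rU_def)
  qed
  have "mat_block N A k k \<in> CoLT N" if k: "k < M" for k
    unfolding CoLT_eq_minors_mat
  proof (rule minors_matI)
    fix p q c d assume pq: "(p, q, c, d) \<in> CoLT_minors N"
    then have "(k * N + p, k * N + q, k * N + c, k * N + d) \<in> block_CoLT_minors N M"
      using k unfolding block_CoLT_minors_def by blast
    moreover have "p < N" "q < N" "c < N" "d < N"
      using pq CoLT_minors_subset[of N] by auto
    ultimately show "mat_block N A k k $$ (p, c) * mat_block N A k k $$ (q, d)
        = mat_block N A k k $$ (p, d) * mat_block N A k k $$ (q, c)"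
      using minors_matD(3)[OF A] by (simp add: index_mat_block)
  qed (use k in \<open>auto simp: index_mat_block mat_block_carrier nz\<close>)
  moreover have "A $$ (Suc i * N + a, j * N + b) = rL $ (i * N + a) * A $$ (i * N + a, j * N + b)"
    if "Suc i < M" "j \<le> i" "a < N" "b < N" for i j a b
  proof -
    \<comment> \<open>Column 0 is written as offset 0 of block column 0 to exhibit it as an instance
      of the lower family.\<close>
    have "(Suc i * N + a, i * N + a, j * N + b, 0 * N + 0) \<in> block_CoLT_minors N M"
      unfolding block_CoLT_minors_def using that by fastforce
    from minors_matD(3)[OF A this] show ?thesis
      unfolding idx(1)[OF that(1,3)] using that nz0[of i a]
      by (simp add: divide_simps mult_ac del: mult_Suc)
  qed
  moreover have "A $$ (i * N + a, j * N + b) = rU $ (i * N + a) * A $$ (Suc i * N + a, j * N + b)"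
    if "Suc i \<le> j" "j < M" "a < N" "b < N" for i j a b
  proof -
    have SucM: "Suc i < M" using that by simp
    \<comment> \<open>Block column \<open>M - 1\<close>, which contains \<open>c\<close>, is
      admissible for every pair of consecutive block rows.\<close>
    have "Suc i \<le> M - 1" "M - 1 < M" "N - 1 < N" using that by auto
    then have "(i * N + a, Suc i * N + a, j * N + b, c) \<in> block_CoLT_minors N M"
      unfolding block_CoLT_minors_def c_def using that by blast
    from minors_matD(3)[OF A this] show ?thesis
      unfolding idx(2)[OF SucM that(3)] using that nz0[of "Suc i" a]
      by (simp add: divide_simps mult_ac del: mult_Suc)
  qed
  ultimately show "A \<in> block_CoLT N M"
    unfolding block_CoLT_def mat_block_eq_diag_mult_iff
    using nzr minors_matD(1)[OF A] by blast
qed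

lemma block_CoLT_eq_minors_mat:
  assumes "N \<ge> 1" "M \<ge> 1"
  shows "block_CoLT N M = minors_mat (M * N) (block_CoLT_minors N M)"
  using block_CoLT_subset_minors_mat minors_mat_subset_block_CoLT[OF assms] by blast

theorem theorem5p2:
  fixes N M :: nat
  assumes "N \<ge> 1" and "M \<ge> 1"
  shows "comm_group (CoLT_group N M) \<and>
    (\<forall>x \<in> nz_vec (M * N).
       bij_betw (\<lambda>A. diag_vec x * A) (block_CoLT N M) (block_CoLT N M) \<and>
       bij_betw (\<lambda>A. A * diag_vec x) (block_CoLT N M) (block_CoLT N M))"
  \<comment> \<open>With the carrier rewritten as a class of prescribed minors, all three claims are
    instances of the general results for in-range quadruples.\<close>
  unfolding CoLT_group_def block_CoLT_eq_minors_mat[OF assms]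
  by (intro conjI ballI comm_group_minors_mat bij_betw_diag_vec_mult_minors_mat
      bij_betw_mult_diag_vec_minors_mat block_CoLT_minors_subset)

end
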